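(* On the diagonal $\beta=\alpha$, with $A=\alpha^2$, one has, as an identity of formal Laurent series at $Z=\infty$ (i.e. in $Z^{-1}$), $$F(Z+4)\,Z(Z+2)=F(Z)\bigl((Z+1)^2-4A\bigr).$$ Equivalently, after the exact gauge factor $\Gamma(Z)$ is adjoined, $\mathcal G:=\Gamma(Z)F(Z)$ (understood through its corresponding asymptotic expansion, with $\Gamma(Z+4)/\Gamma(Z)=Z(Z+1)(Z+2)(Z+3)$ exactly) satisfies $$\mathcal G(Z+4)=(Z+1)(Z+3)\bigl((Z+1)^2-4A\bigr)\mathcal G(Z).$$ For half-odd-integer $\alpha$ these identities are identities of rational (respectively Gamma-quotient) functions of $Z$; for general $\alpha$ the assertion is coefficientwise in $Z^{-1}$.
   Context: For $\nu\in\mathbb C$ and $k\ge0$ let $a_k(\nu)=\dfrac{(\frac12+\nu)_k(\frac12-\nu)_k}{(-2)^k k!}$ ($(x)_k$ is the Pochhammer symbol). Let $p=1+i$, $q=1-i$. On the diagonal $\beta=\alpha$ put $G_n=\sum_{l=0}^n a_l(\alpha)a_{n-l}(\alpha)p^lq^{n-l}$ and $$F(Z)=\sum_{n\ge0}\frac{G_n}{(Z-1)(Z-2)\cdots(Z-n)},$$ regarded as a formal power series in $Z^{-1}$ (each summand expanded at $Z=\infty$). For half-odd-integer $\alpha$ the sum is finite, so $F$ is a rational function of $Z$. $F(Z+4)$ denotes the formal series obtained by replacing $Z$ with $Z+4$ and re-expanding in $Z^{-1}$. *)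

theory Defs
  imports
    "HOL-Complex_Analysis.Complex_Analysis"
begin

definition a_coeff :: "complex \<Rightarrow> nat \<Rightarrow> complex" where
  "a_coeff \<nu> k =
     pochhammer (1/2 + \<nu>) k * pochhammer (1/2 - \<nu>) k / ((-2) ^ k * fact k)"

definition G_coeff :: "complex \<Rightarrow> nat \<Rightarrow> complex" where
  "G_coeff \<alpha> n =
     (\<Sum>l=0..n. a_coeff \<alpha> l * a_coeff \<alpha> (n - l) * (1 + \<i>) ^ l * (1 - \<i>) ^ (n - l))"

text \<open>
  Formal Laurent series at \<open>Z = \<infinity>\<close> are elements of \<^typ>\<open>complex fls\<close>, whose indeterminate
  \<^const>\<open>fls_X\<close> stands for \<open>1/Z\<close>. Since \<^typ>\<open>complex fls\<close> is a field, division there is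
  expansion at \<open>Z = \<infinity>\<close>.
\<close>

abbreviation Z_ser :: "complex fls" where
  "Z_ser \<equiv> fls_X_inv"

text \<open>The infinite sum is taken in the \<open>1/Z\<close>-adic metric of \<^typ>\<open>complex fls\<close>.\<close>

definition F_term :: "complex \<Rightarrow> nat \<Rightarrow> complex fls" where
  "F_term \<alpha> n = fls_const (G_coeff \<alpha> n) / (\<Prod>j=1..n. Z_ser - of_nat j)"

definition F_ser :: "complex \<Rightarrow> complex fls" where
  "F_ser \<alpha> = (\<Sum>n. F_term \<alpha> n)"

text \<open>\<open>f(Z) \<mapsto> f(Z + 4)\<close>: the indeterminate \<open>w = 1/Z\<close> is replaced by \<open>1/(Z + 4) = w/(1 + 4w)\<close>.\<close>

definition shift4 :: "complex fls \<Rightarrow> complex fls" where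
  "shift4 f = fls_compose_fps f (fps_X / (1 + 4 * fps_X))"

text \<open>
  Adjoining the gauge factor: a polynomial over \<^typ>\<open>complex fls\<close> is a polynomial in the symbol
  \<open>\<Gamma>(Z)\<close>, and \<open>Z \<mapsto> Z + 4\<close> acts by \<^const>\<open>shift4\<close> on coefficients and by
  \<open>\<Gamma>(Z + 4) = Z (Z + 1) (Z + 2) (Z + 3) \<Gamma>(Z)\<close> on the symbol.
\<close>

definition Gamma_sym :: "complex fls poly" where
  "Gamma_sym = [:0, 1:]"

definition shift4_gauged :: "complex fls poly \<Rightarrow> complex fls poly" where
  "shift4_gauged P =
     pcompose (map_poly shift4 P)
       (smult (Z_ser * (Z_ser + 1) * (Z_ser + 2) * (Z_ser + 3)) Gamma_sym)"

definition G_gauged :: "complex \<Rightarrow> complex fls poly" where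
  "G_gauged \<alpha> = smult (F_ser \<alpha>) Gamma_sym"

text \<open>
  The rational function given by \<open>F\<close> when only finitely many \<^term>\<open>G_coeff \<alpha> n\<close> are nonzero,
  which is the case for half-odd-integer \<open>\<alpha>\<close> (lemma \<open>finite_G_coeff\<close> below). It is used as a
  function only away from the zeros of the denominators that occur.
\<close>

definition F_rat :: "complex \<Rightarrow> complex \<Rightarrow> complex" where
  "F_rat \<alpha> z = (\<Sum>n | G_coeff \<alpha> n \<noteq> 0. G_coeff \<alpha> n / (\<Prod>j=1..n. z - of_nat j))"

definition F_poles :: "complex \<Rightarrow> complex set" where
  "F_poles \<alpha> = {of_nat j | j n. 1 \<le> j \<and> j \<le> n \<and> G_coeff \<alpha> n \<noteq> 0}"

definition G_fun :: "complex \<Rightarrow> complex \<Rightarrow> complex" where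
  "G_fun \<alpha> z = Gamma z * F_rat \<alpha> z"


lemma Gamma_plus4:
  fixes z :: complex
  assumes "z \<notin> \<int>\<^sub>\<le>\<^sub>0"
  shows "Gamma (z + 4) = z * (z + 1) * (z + 2) * (z + 3) * Gamma z"
proof -
  have "Gamma (z + 4) / Gamma z = pochhammer z 4"
    using pochhammer_Gamma[OF assms, of 4] by simp
  moreover have "Gamma z \<noteq> 0"
    using assms by (simp add: Gamma_eq_zero_iff)
  moreover have "pochhammer z 4 = z * (z + 1) * (z + 2) * (z + 3)"
    by (simp add: eval_nat_numeral pochhammer_Suc algebra_simps)
  ultimately show ?thesis
    by (simp add: field_simps)
qed

lemma F_term_nth_eq_0:
  assumes "k < int n"
  shows "fls_nth (F_term \<alpha> n) k = 0"
proof (cases "G_coeff \<alpha> n = 0")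
  case True
  then show ?thesis by (simp add: F_term_def)
next
  case False
  have sub: "fls_subdegree (Z_ser - of_nat j) = -1" for j :: nat
    by (intro fls_subdegree_eqI) (auto simp: fls_of_nat_nth)
  then have nz: "Z_ser - of_nat j \<noteq> 0" for j :: nat
    by (metis fls_zero_subdegree zero_neq_neg_one)
  have "fls_subdegree (\<Prod>j=1..n. Z_ser - of_nat j) = - int n"
    using nz sub by (subst fls_subdegree_prod) auto
  moreover have "(\<Prod>j=1..n. Z_ser - of_nat j) \<noteq> 0"
    using nz by simp
  moreover have "fls_const (G_coeff \<alpha> n) \<noteq> 0"
    using False by (simp add: fls_const_nonzero)
  ultimately have "fls_subdegree (F_term \<alpha> n) = int n"
    unfolding F_term_def
    by (metis fls_divide_subdegree fls_const_subdegree diff_0 minus_minus)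
  then show ?thesis using assms by simp
qed

lemma F_term_summable: "summable (F_term \<alpha>)"
proof -
  define H where "H = fps_to_fls (Abs_fps (\<lambda>k. \<Sum>n\<le>k. fls_nth (F_term \<alpha> n) (int k)))"
  have coeff: "fls_nth (\<Sum>n<N. F_term \<alpha> n) k = fls_nth H k" if "k < int N" for N k
  proof (cases "k < 0")
    case True
    then show ?thesis
      by (simp add: H_def fls_nth_sum F_term_nth_eq_0)
  next
    case False
    have "(\<Sum>n<N. fls_nth (F_term \<alpha> n) k) = (\<Sum>n\<le>nat k. fls_nth (F_term \<alpha> n) k)"
      using that False by (intro sum.mono_neutral_right) (auto intro!: F_term_nth_eq_0)
    then show ?thesis using False by (simp add: H_def fls_nth_sum)
  qed
  have dist: "dist (\<Sum>n<N. F_term \<alpha> n) H \<le> (1/2) ^ N" for N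
  proof (cases "(\<Sum>n<N. F_term \<alpha> n) = H")
    case False
    let ?s = "fls_subdegree ((\<Sum>n<N. F_term \<alpha> n) - H)"
    have "?s \<ge> int N"
      using False coeff by (intro fls_subdegree_geI) auto
    then have "N \<le> nat ?s" "?s \<ge> 0" by auto
    then have "(1/2 :: real) ^ nat ?s \<le> (1/2) ^ N"
      by (intro power_decreasing) auto
    then show ?thesis
      using False \<open>?s \<ge> 0\<close>
      unfolding dist_fls_def by (simp only: if_False if_True power_one_over inverse_eq_divide)
  qed simp
  have "(\<lambda>N. (1/2 :: real) ^ N) \<longlonglongrightarrow> 0"
    by (intro LIMSEQ_realpow_zero) auto
  then have "(\<lambda>N. dist (\<Sum>n<N. F_term \<alpha> n) H) \<longlonglongrightarrow> 0"
    by (rule tendsto_0_le[where K = 1]) (simp add: dist)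
  then have "F_term \<alpha> sums H"
    unfolding sums_def by (rule iffD2[OF tendsto_dist_iff])
  then show ?thesis by (rule sums_summable)
qed

lemma shift4_Z: "shift4 Z_ser = Z_ser + 4"
proof -
  let ?d = "1 + 4 * fps_X :: complex fps"
  let ?g = "fps_X / ?d"
  have d0: "fps_nth ?d 0 \<noteq> 0" by simp
  have g_eq: "?g = fps_X * inverse ?d"
    using d0 by (simp add: fps_divide_unit)
  have inv: "inverse ?d * ?d = 1"
    using d0 by (rule inverse_mult_eq_1)
  then have gd: "?g * ?d = fps_X"
    unfolding g_eq by (simp add: mult.assoc)
  then have g0: "?g \<noteq> 0" by (metis mult_zero_left fps_X_neq_zero)
  have gn: "fps_nth ?g 0 = 0" unfolding g_eq by simp
  have "shift4 Z_ser = inverse (fps_to_fls ?g)"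
    unfolding shift4_def fls_inverse_X[symmetric]
    using fls_compose_fps_inverse[OF g0 gn, of fls_X] by simp
  also have "\<dots> = (fls_X_inv + 4)"
  proof -
    have "fps_to_fls ?g * fps_to_fls ?d = fls_X"
      by (metis gd fls_times_fps_to_fls fps_X_to_fls)
    moreover have "fps_to_fls ?d = 1 + 4 * fls_X"
      by (simp add: fls_times_fps_to_fls fps_to_fls_plus)
    moreover have "1 + 4 * fls_X = (fls_X :: complex fls) * (fls_X_inv + 4)"
      by (simp add: distrib_left mult.commute flip: fls_inverse_X)
    ultimately have "fps_to_fls ?g * (fls_X * (fls_X_inv + 4)) = fls_X"
      by simp
    then have "fls_X * (fps_to_fls ?g * (fls_X_inv + 4)) = fls_X * 1"
      by (simp only: mult.left_commute mult_1_right)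
    then have "fps_to_fls ?g * (fls_X_inv + 4) = 1"
      by (subst (asm) mult_cancel_left) auto
    then show ?thesis by (simp add: inverse_unique)
  qed
  finally show ?thesis .
qed

lemma a_coeff_eq_0:
  assumes "\<alpha> = 1/2 + of_int m" "nat \<bar>m\<bar> + 1 < k"
  shows "a_coeff \<alpha> k = 0"
proof (cases "m \<ge> 0")
  case True
  have "1/2 - \<alpha> = - of_nat (nat m)" using assms True by simp
  moreover have "pochhammer (- of_nat (nat m) :: complex) k = 0"
    using assms True by (intro pochhammer_of_nat_eq_0_lemma) auto
  ultimately show ?thesis unfolding a_coeff_def by simp
next
  case False
  have "1/2 + \<alpha> = - of_nat (nat (- m - 1))" using assms False by simp
  moreover have "pochhammer (- of_nat (nat (- m - 1)) :: complex) k = 0"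
    using assms False by (intro pochhammer_of_nat_eq_0_lemma) auto
  ultimately show ?thesis unfolding a_coeff_def by simp
qed

lemma finite_G_coeff:
  assumes "\<alpha> - 1/2 \<in> \<int>"
  shows "finite {n. G_coeff \<alpha> n \<noteq> 0}"
proof -
  obtain m where m: "\<alpha> = 1/2 + of_int m"
    using assms by (metis Ints_cases add.commute diff_add_cancel)
  define M where "M = nat \<bar>m\<bar> + 1"
  have "G_coeff \<alpha> n = 0" if "n > 2 * M" for n
    unfolding G_coeff_def
  proof (intro sum.neutral ballI)
    fix l assume "l \<in> {0..n}"
    then have "l > M \<or> n - l > M" using that by auto
    then show "a_coeff \<alpha> l * a_coeff \<alpha> (n - l) * (1 + \<i>) ^ l * (1 - \<i>) ^ (n - l) = 0"
      using a_coeff_eq_0[OF m] unfolding M_def by auto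
  qed
  then have "{n. G_coeff \<alpha> n \<noteq> 0} \<subseteq> {..2 * M}" by (auto simp: not_less[symmetric])
  then show ?thesis by (rule finite_subset) simp
qed

end

theory Submission
  imports Defs
begin

text \<open>
  Since \<open>1 / ((Z - 1) \<cdots> (Z - n)) = \<Gamma>(Z - n) / \<Gamma>(Z)\<close>, the product \<open>\<Gamma>(Z) F(Z)\<close> is the formal
  Mellin transform of \<open>exp (- s) g(1/s)\<close>, where \<open>g(x) = \<Sum> G\<^sub>n x\<^sup>n\<close>. The series \<open>\<Sum> a\<^sub>k(\<alpha>) / s\<^sup>k\<close> is
  the asymptotic series of the Macdonald function \<open>K\<^sub>\<alpha>(s)\<close> without its prefactor
  \<open>exp (- s) (\<pi> / (2 s))\<^sup>1\<^sup>/\<^sup>2\<close>, and \<open>g(1/s)\<close> is the product of two copies of it at \<open>s / p\<close> and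
  \<open>s / q\<close>. As \<open>1/p + 1/q = 1\<close>, up to a constant \<open>exp (- s) g(1/s)\<close> is
  \<open>s K\<^sub>\<alpha>(s/p) K\<^sub>\<alpha>(s/q)\<close>.

  With \<open>\<theta> = s d/ds\<close>, the factors satisfy \<open>\<theta>\<^sup>2 u = (\<alpha>\<^sup>2 + s\<^sup>2/p\<^sup>2) u\<close> and
  \<open>\<theta>\<^sup>2 v = (\<alpha>\<^sup>2 + s\<^sup>2/q\<^sup>2) v\<close>. A product of solutions of two second order equations satisfies a
  fourth order equation, and here \<open>1/p\<^sup>2 + 1/q\<^sup>2 = 0\<close> makes it collapse to the two-term equation
  \<open>\<theta> (\<theta> - 2) (\<theta>\<^sup>2 - 4 \<alpha>\<^sup>2) (u v) = s\<^sup>4 u v\<close> (lemma \<open>product_ode\<close>). The Mellin transform turns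
  \<open>\<theta>\<close> into multiplication by a linear polynomial in \<open>Z\<close> (\<open>mellin_twisted_deriv\<close>) and
  multiplication by \<open>s\<^sup>4\<close> into the shift \<open>Z \<mapsto> Z + 4\<close> (\<open>mellin_shift4\<close>), so the differential equation
  becomes the difference equation for \<open>\<Gamma>(Z) F(Z)\<close>. All of this is done on formal Laurent series:
  the exponential and the power of \<open>s\<close> are conjugated away, which replaces \<open>\<theta>\<close> by a twisted
  derivative, and the Mellin transform becomes the map \<open>x\<^sup>n \<mapsto> \<Gamma>(Z - n) / \<Gamma>(Z)\<close>.

  For half-odd-integer \<open>\<alpha>\<close> the series \<open>F\<close> is the expansion at infinity of a quotient of polynomials.
  Cleared of denominators, the identity of series is an identity of polynomials, because expansion
  at infinity is injective; evaluated at \<open>z\<close>, it gives the identity of functions.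
\<close>

section \<open>The differential equation\<close>

text \<open>
  In this section \<^const>\<open>fls_X\<close> is the variable \<open>x = 1/s\<close>, so \<open>x d/dx = - \<theta>\<close>. With
  \<open>\<kappa> = r + c/x\<close> the operator below is \<open>x d/dx\<close> conjugated by \<open>x\<^sup>r exp (- c/x)\<close>, which is not a
  Laurent series.
\<close>

definition twisted_deriv :: "complex fls \<Rightarrow> complex fls \<Rightarrow> complex fls" where
  "twisted_deriv \<kappa> f = fls_X * fls_deriv f + \<kappa> * f"

lemma twisted_deriv_add: "twisted_deriv \<kappa> (f + g) = twisted_deriv \<kappa> f + twisted_deriv \<kappa> g"
  by (simp add: twisted_deriv_def algebra_simps)

lemma twisted_deriv_diff: "twisted_deriv \<kappa> (f - g) = twisted_deriv \<kappa> f - twisted_deriv \<kappa> g"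
  by (simp add: twisted_deriv_def algebra_simps)

lemma twisted_deriv_const_mult:
  "twisted_deriv \<kappa> (fls_const c * f) = fls_const c * twisted_deriv \<kappa> f"
  by (simp add: twisted_deriv_def algebra_simps)

text \<open>
  Product rule: the twists add up, as the prefactors \<open>x\<^sup>r exp (- c/x)\<close> multiply.
\<close>

lemma twisted_deriv_mult:
  "twisted_deriv (\<kappa> + \<mu>) (f * g) = twisted_deriv \<kappa> f * g + f * twisted_deriv \<mu> g"
  by (simp add: twisted_deriv_def algebra_simps)

lemma fls_X_times_X_inv: "fls_X * fls_X_inv = (1 :: complex fls)"
  by (simp flip: fls_inverse_X)

lemma twisted_deriv_X_inv_square:
  "twisted_deriv (\<kappa> + 2) (fls_X_inv\<^sup>2 * f) = fls_X_inv\<^sup>2 * twisted_deriv \<kappa> f"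
proof -
  have "fls_X * fls_deriv (fls_X_inv\<^sup>2) =
      - (fls_X * fls_X_inv) * (fls_X_inv\<^sup>2 + fls_X_inv\<^sup>2 :: complex fls)"
    by (simp add: power2_eq_square algebra_simps)
  then have "fls_X * fls_deriv (fls_X_inv\<^sup>2) = - 2 * (fls_X_inv\<^sup>2 :: complex fls)"
    by (simp add: fls_X_times_X_inv)
  moreover have "twisted_deriv (\<kappa> + 2) (fls_X_inv\<^sup>2 * f) =
      (fls_X * fls_deriv (fls_X_inv\<^sup>2)) * f + 2 * fls_X_inv\<^sup>2 * f
      + fls_X_inv\<^sup>2 * twisted_deriv \<kappa> f"
    by (simp add: twisted_deriv_def algebra_simps)
  ultimately show ?thesis
    by simp
qed

text \<open>
  The formal expansion of \<open>(2 s / (\<pi> p))\<^sup>1\<^sup>/\<^sup>2 exp (s/p) K\<^sub>\<alpha>(s/p)\<close> in \<open>x = 1/s\<close>.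
\<close>

definition bessel_series :: "complex \<Rightarrow> complex \<Rightarrow> complex fls" where
  "bessel_series \<alpha> p = fps_to_fls (Abs_fps (\<lambda>k. a_coeff \<alpha> k * p ^ k))"

lemma a_coeff_Suc:
  "2 * of_nat (Suc k) * a_coeff \<alpha> (Suc k) = (\<alpha>\<^sup>2 - (of_nat k + 1/2)\<^sup>2) * a_coeff \<alpha> k"
proof -
  have "a_coeff \<alpha> (Suc k) =
      a_coeff \<alpha> k * ((1/2 + \<alpha> + of_nat k) * (1/2 - \<alpha> + of_nat k)) / (- 2 * of_nat (Suc k))"
    unfolding a_coeff_def pochhammer_Suc fact_Suc power_Suc of_nat_mult
    by (simp only: times_divide_eq_left times_divide_eq_right divide_divide_eq_left mult_ac)
  moreover have "(of_nat (Suc k) :: complex) \<noteq> 0"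
    by (rule of_nat_neq_0)
  ultimately show ?thesis
    by (simp add: field_simps power2_eq_square del: of_nat_Suc)
qed

text \<open>
  The modified Bessel equation \<open>\<theta>\<^sup>2 w = (\<alpha>\<^sup>2 + c\<^sup>2 s\<^sup>2) w\<close> for \<open>w = K\<^sub>\<alpha>(c s)\<close>, where \<open>c = 1/p\<close>, with the
  prefactor \<open>x\<^sup>1\<^sup>/\<^sup>2 exp (- c/x)\<close> conjugated into the operator. Expanded, the double poles cancel, and
  what remains is the recurrence of \<open>a_coeff_Suc\<close>.
\<close>

lemma bessel_series_ode:
  fixes \<alpha> c p :: complex
  assumes "c * p = 1"
  defines "\<kappa> \<equiv> fls_const (1/2) + fls_const c * fls_X_inv"
  defines "u \<equiv> bessel_series \<alpha> p"
  shows "twisted_deriv \<kappa> (twisted_deriv \<kappa> u) =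
           (fls_const (\<alpha>\<^sup>2) + fls_const (c\<^sup>2) * fls_X_inv\<^sup>2) * u"
proof -
  define D where "D f = fls_X * fls_deriv f" for f :: "complex fls"
  have D_nth: "fls_nth (D f) n = of_int n * fls_nth f n" for f n
    by (simp add: D_def fls_X_times_conv_shift)
  have u_nth: "fls_nth u n = (if n < 0 then 0 else a_coeff \<alpha> (nat n) * p ^ nat n)" for n
    by (simp add: u_def bessel_series_def)
  \<comment> \<open>The recurrence of the coefficients as a differential equation. At \<open>n = - 1\<close> both sides vanish
      because of the factor \<open>n + 1\<close>.\<close>
  have hyp: "fls_const (2 * c) * (fls_X_inv * D u) =
      fls_const (\<alpha>\<^sup>2 - 1/4) * u - D u - D (D u)"
  proof (rule fls_eqI)
    fix n :: int
    have "2 * c * (of_int (n + 1) * fls_nth u (n + 1)) =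
        (\<alpha>\<^sup>2 - 1/4 - of_int n - (of_int n)\<^sup>2) * fls_nth u n"
    proof (cases "n < 0")
      case True
      then show ?thesis by (cases "n = -1") (auto simp: u_nth)
    next
      case False
      then obtain k where k: "n = int k" by (metis nonneg_int_cases not_less)
      have "2 * c * (of_int (n + 1) * fls_nth u (n + 1)) =
          (2 * of_nat (Suc k) * a_coeff \<alpha> (Suc k)) * (c * p) * p ^ k"
        by (simp add: k u_nth nat_add_distrib mult_ac)
      also have "\<dots> = (\<alpha>\<^sup>2 - (of_nat k + 1/2)\<^sup>2) * (a_coeff \<alpha> k * p ^ k)"
        by (simp only: a_coeff_Suc assms) simp
      also have "\<dots> = (\<alpha>\<^sup>2 - 1/4 - of_int n - (of_int n)\<^sup>2) * fls_nth u n"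
        by (simp add: k u_nth power2_eq_square algebra_simps)
      finally show ?thesis .
    qed
    then show "fls_nth (fls_const (2 * c) * (fls_X_inv * D u)) n =
        fls_nth (fls_const (\<alpha>\<^sup>2 - 1/4) * u - D u - D (D u)) n"
      by (simp add: D_nth fls_X_inv_times_conv_shift power2_eq_square algebra_simps)
  qed
  have DX: "D fls_X_inv = - fls_X_inv"
  proof -
    have "D fls_X_inv = - (fls_X * fls_X_inv) * fls_X_inv"
      by (simp add: D_def power2_eq_square algebra_simps)
    then show ?thesis by (simp add: fls_X_times_X_inv)
  qed
  have D_mult: "D (f * g) = D f * g + f * D g" and D_add: "D (f + g) = D f + D g"
    and D_const: "D (fls_const a) = 0" for f g a
    by (simp_all add: D_def algebra_simps)
  have half: "fls_const (1/2) + fls_const (1/2) = (1 :: complex fls)"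
    by (simp add: fls_plus_const)
  have quarter: "fls_const (\<alpha>\<^sup>2 - 1/4) = fls_const (\<alpha>\<^sup>2) - fls_const (1/2) * fls_const (1/2)"
    by (simp add: fls_eq_iff)
  have two: "fls_const (2 * c) = fls_const c + fls_const c"
    by (simp add: fls_plus_const)
  have csq: "fls_const (c\<^sup>2) = fls_const c * fls_const c"
    by (simp add: power2_eq_square)
  define h where "h = (fls_const (1/2) :: complex fls)"
  have "twisted_deriv \<kappa> (twisted_deriv \<kappa> u) =
     D (D u) + (h + h) * D u + h * h * u + (fls_const c + fls_const c) * (fls_X_inv * D u)
     + fls_const c * (h + h) * fls_X_inv * u + fls_const c * D fls_X_inv * u
     + fls_const c * fls_const c * fls_X_inv\<^sup>2 * u"
    unfolding twisted_deriv_def D_def[symmetric] \<kappa>_def D_mult D_add D_const h_def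
    by (simp add: algebra_simps power2_eq_square)
  also have "\<dots> = (fls_const (\<alpha>\<^sup>2) + fls_const (c\<^sup>2) * fls_X_inv\<^sup>2) * u"
    using hyp half unfolding two quarter csq h_def[symmetric] DX
    by (simp add: algebra_simps)
  finally show ?thesis .
qed


text \<open>
  Write \<open>u'\<close>, \<open>v'\<close> for the twisted derivatives of the two factors and \<open>y = 1/x\<close>. In the second derivative
  of \<open>u v\<close> the terms with \<open>y\<^sup>2\<close> cancel because \<open>c\<^sup>2 + d\<^sup>2 = 0\<close>, which leaves
  \<open>(\<delta>\<^sup>2 - 4 A) (u v) = 2 (u' v' - A u v)\<close>. One more derivative gives \<open>2 c\<^sup>2 y\<^sup>2 (u v' - u' v)\<close>, a multiple
  of the Wronskian. To differentiate it, pull \<open>y\<^sup>2\<close> out at the cost of raising the twist by 2; the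
  derivative of the Wronskian is \<open>- 2 c\<^sup>2 y\<^sup>2 u v\<close>. The final constant is
  \<open>- 4 c\<^sup>4 = 1\<close>, as \<open>c + d = 1\<close> and \<open>c\<^sup>2 + d\<^sup>2 = 0\<close> imply \<open>2 c\<^sup>2 = 2 c - 1\<close>.
\<close>

lemma product_ode:
  fixes u v :: "complex fls" and A c d :: complex
  assumes cd: "c + d = 1" "c\<^sup>2 + d\<^sup>2 = 0"
  defines "\<kappa> \<equiv> fls_const (1/2) + fls_const c * fls_X_inv"
  defines "\<mu> \<equiv> fls_const (1/2) + fls_const d * fls_X_inv"
  assumes u: "twisted_deriv \<kappa> (twisted_deriv \<kappa> u) =
                (fls_const A + fls_const (c\<^sup>2) * fls_X_inv\<^sup>2) * u"
  assumes v: "twisted_deriv \<mu> (twisted_deriv \<mu> v) =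
                (fls_const A + fls_const (d\<^sup>2) * fls_X_inv\<^sup>2) * v"
  defines "\<delta> \<equiv> twisted_deriv (1 + fls_X_inv)"
  shows "twisted_deriv (3 + fls_X_inv) (\<delta> (\<delta> (\<delta> (u * v)) - fls_const (4 * A) * (u * v))) =
           fls_X_inv ^ 4 * (u * v)"
proof -
  define u' where "u' = twisted_deriv \<kappa> u"
  define v' where "v' = twisted_deriv \<mu> v"
  let ?C = "fls_const (c\<^sup>2)" and ?Y = "fls_X_inv :: complex fls"
  have "\<kappa> + \<mu> = fls_const (1/2 + 1/2) + fls_const (c + d) * fls_X_inv"
    unfolding \<kappa>_def \<mu>_def fls_plus_const[symmetric] by (simp add: algebra_simps)
  then have \<kappa>\<mu>: "1 + fls_X_inv = \<kappa> + \<mu>"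
    using cd by simp
  have \<delta>_mult: "\<delta> (f * g) = twisted_deriv \<kappa> f * g + f * twisted_deriv \<mu> g" for f g
    unfolding \<delta>_def \<kappa>\<mu> by (rule twisted_deriv_mult)
  have lin: "\<delta> (f + g) = \<delta> f + \<delta> g" "\<delta> (f - g) = \<delta> f - \<delta> g"
    "\<delta> (fls_const a * f) = fls_const a * \<delta> f" for f g a
    by (simp_all only: \<delta>_def twisted_deriv_add twisted_deriv_diff twisted_deriv_const_mult)
  have dsq: "fls_const (d\<^sup>2) = - ?C"
  proof -
    have "d\<^sup>2 = - c\<^sup>2"
      using cd(2) by (metis add_eq_0_iff)
    then show ?thesis
      by simp
  qed
  have u'': "twisted_deriv \<kappa> u' = (fls_const A + ?C * ?Y\<^sup>2) * u"
    using u by (simp add: u'_def)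
  have v'': "twisted_deriv \<mu> v' = (fls_const A - ?C * ?Y\<^sup>2) * v"
    using v dsq by (simp add: v'_def)
  have four: "fls_const (4 * A) = 2 * fls_const A + 2 * fls_const A"
    by (simp flip: fls_const_mult_const)
  have two: "fls_const 2 = (2 :: complex fls)"
    by simp
  have \<delta>1: "\<delta> (u * v) = u' * v + u * v'"
    by (simp only: \<delta>_mult u'_def v'_def)
  have "\<delta> (\<delta> (u * v)) - fls_const (4 * A) * (u * v) =
      fls_const 2 * (u' * v' - fls_const A * (u * v))"
    unfolding \<delta>1 lin(1) \<delta>_mult u'_def[symmetric] v'_def[symmetric] u'' v'' four two
    by (simp add: algebra_simps)
  moreover have "\<delta> (u' * v' - fls_const A * (u * v)) = ?C * (?Y\<^sup>2 * (u * v' - u' * v))"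
    unfolding lin unfolding \<delta>_mult u'_def[symmetric] v'_def[symmetric] u'' v''
    by (simp add: algebra_simps)
  ultimately have "\<delta> (\<delta> (\<delta> (u * v)) - fls_const (4 * A) * (u * v)) =
      fls_const (2 * c\<^sup>2) * (?Y\<^sup>2 * (u * v' - u' * v))"
    by (simp only: lin fls_const_mult_const[symmetric] mult.assoc)
  moreover have "twisted_deriv (3 + fls_X_inv) (fls_X_inv\<^sup>2 * f) = ?Y\<^sup>2 * \<delta> f" for f
    using twisted_deriv_X_inv_square[of "1 + fls_X_inv" f] by (simp add: \<delta>_def)
  moreover have "\<delta> (u * v' - u' * v) = fls_const (- 2 * c\<^sup>2) * (?Y\<^sup>2 * (u * v))"
  proof -
    have "fls_const (- 2 * c\<^sup>2) = - ?C - ?C"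
      by (simp add: fls_eq_iff)
    then show ?thesis
      unfolding lin unfolding \<delta>_mult u'_def[symmetric] v'_def[symmetric] u'' v''
      by (simp add: algebra_simps)
  qed
  moreover have "(2 * c\<^sup>2) * (- 2 * c\<^sup>2) = 1"
  proof -
    have d: "d = 1 - c"
      using cd(1) by (simp add: eq_diff_eq add.commute)
    have "2 * c\<^sup>2 = 2 * c - 1"
      using cd(2) unfolding d by (simp add: power2_eq_square algebra_simps)
    then have "(2 * c\<^sup>2) * (- 2 * c\<^sup>2) = - (2 * c - 1) * (2 * c - 1)"
      by simp
    also have "\<dots> = 2 * (2 * c - 2 * c\<^sup>2) - 1"
      by (simp add: power2_eq_square algebra_simps)
    also have "\<dots> = 1"
      using \<open>2 * c\<^sup>2 = 2 * c - 1\<close> by simp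
    finally show ?thesis .
  qed
  then have "fls_const (2 * c\<^sup>2) * fls_const (- 2 * c\<^sup>2) = 1"
    unfolding fls_const_mult_const by simp
  moreover have "a * (y\<^sup>2 * (b * (y\<^sup>2 * w))) = y ^ 4 * w" if "a * b = 1"
    for a b y w :: "complex fls"
  proof -
    have "y ^ 4 = y\<^sup>2 * y\<^sup>2"
      by (simp flip: power_add)
    then have "a * (y\<^sup>2 * (b * (y\<^sup>2 * w))) = (a * b) * (y ^ 4 * w)"
      by (simp only: mult_ac)
    then show ?thesis
      by (simp only: that mult_1_left)
  qed
  ultimately show ?thesis
    by (simp only: twisted_deriv_const_mult)
qed

lemma G_series:
  "bessel_series \<alpha> (1 + \<i>) * bessel_series \<alpha> (1 - \<i>) = fps_to_fls (Abs_fps (G_coeff \<alpha>))"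
proof -
  have "Abs_fps (\<lambda>k. a_coeff \<alpha> k * (1 + \<i>) ^ k) * Abs_fps (\<lambda>k. a_coeff \<alpha> k * (1 - \<i>) ^ k) =
      Abs_fps (G_coeff \<alpha>)"
    unfolding fps_eq_iff fps_mult_nth fps_nth_Abs_fps G_coeff_def
    by (auto intro!: sum.cong)
  then show ?thesis
    by (simp only: bessel_series_def fls_times_fps_to_fls[symmetric])
qed

section \<open>The formal Mellin transform\<close>

text \<open>
  The quotient \<open>\<Gamma>(Z - n) / \<Gamma>(Z)\<close>, as a series in \<open>1/Z\<close>. Negative \<open>n\<close> are needed because the differential
  equation contains \<open>1/x\<close>.
\<close>

definition gamma_ratio :: "int \<Rightarrow> complex fls" where
  "gamma_ratio n =
     (if n \<ge> 0 then 1 / (\<Prod>j=1..nat n. Z_ser - of_nat j) else (\<Prod>j<nat (- n). Z_ser + of_nat j))"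

lemma subdegree_Z_minus: "fls_subdegree (Z_ser - of_int n) = - 1"
  by (intro fls_subdegree_eqI) (auto simp: fls_of_int_nth)

lemma Z_minus_nonzero: "Z_ser - of_int n \<noteq> 0"
  using subdegree_Z_minus[of n] by (metis fls_zero_subdegree zero_neq_neg_one)

text \<open>
  The functional equation of \<open>\<Gamma>\<close>, valid across \<open>n = 0\<close>. It determines \<^const>\<open>gamma_ratio\<close> from its
  value 1 at \<open>n = 0\<close>, so properties of all these quotients follow by induction in both directions.
\<close>

lemma gamma_ratio_minus_1: "gamma_ratio (n - 1) = (Z_ser - of_int n) * gamma_ratio n"
proof (cases "n \<ge> 1")
  case True
  then obtain m where m: "n = int (Suc m)"
    by (metis Suc_le_D int_nat_eq nat_mono nat_1 One_nat_def order_trans zero_le_one)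
  moreover have "nat (1 + int m) = Suc m"
    by simp
  ultimately show ?thesis
    using Z_minus_nonzero[of n] m by (simp add: gamma_ratio_def)
next
  case False
  then obtain m where "n = - int m"
    by (intro that[of "nat (- n)"]) simp
  moreover have "nat (1 + int m) = Suc m"
    by simp
  ultimately show ?thesis
    by (cases "m = 0") (simp_all add: gamma_ratio_def mult.commute)
qed

lemma gamma_ratio_subdegree: "gamma_ratio n \<noteq> 0 \<and> fls_subdegree (gamma_ratio n) = n"
proof (induction n rule: int_induct[where k = 0])
  case base
  then show ?case by (simp add: gamma_ratio_def)
next
  case (step1 i)
  then show ?case
    using gamma_ratio_minus_1[of "i + 1"] Z_minus_nonzero[of "i + 1"] subdegree_Z_minus[of "i + 1"]
    by (cases "gamma_ratio (i + 1) = 0") auto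
next
  case (step2 i)
  then show ?case
    using gamma_ratio_minus_1[of i] Z_minus_nonzero[of i] subdegree_Z_minus[of i]
    by auto
qed

lemma gamma_ratio_nth_eq_0: "k < n \<Longrightarrow> fls_nth (gamma_ratio n) k = 0"
  using gamma_ratio_subdegree[of n] by simp

text \<open>
  The continuous linear extension of \<open>x\<^sup>n \<mapsto> \<Gamma>(Z - n) / \<Gamma>(Z)\<close>, from Laurent series in \<open>x\<close> to Laurent series
  in \<open>1/Z\<close>. It is given by coefficients: \<open>\<Gamma>(Z - n) / \<Gamma>(Z)\<close> has order \<open>n\<close> in \<open>1/Z\<close>, so only
  \<open>n \<le> k\<close> contributes to the coefficient of \<open>Z\<^sup>-\<^sup>k\<close>.
\<close>

definition mellin :: "complex fls \<Rightarrow> complex fls" where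
  "mellin f = Abs_fls (\<lambda>k. \<Sum>n=fls_subdegree f..k. fls_nth f n * fls_nth (gamma_ratio n) k)"

text \<open>
  The summation range may be enlarged at both ends, which provides a common range for several series.
\<close>

lemma mellin_nth:
  assumes "\<And>n. n < m \<Longrightarrow> fls_nth f n = 0" "k \<le> M"
  shows "fls_nth (mellin f) k = (\<Sum>n=m..M. fls_nth f n * fls_nth (gamma_ratio n) k)"
proof -
  have "fls_nth (mellin f) k =
      (\<Sum>n=fls_subdegree f..k. fls_nth f n * fls_nth (gamma_ratio n) k)"
    unfolding mellin_def by (rule nth_Abs_fls_lower_bound[of "fls_subdegree f"]) simp
  also have "\<dots> = (\<Sum>n=min m (fls_subdegree f)..M. fls_nth f n * fls_nth (gamma_ratio n) k)"
    using assms(2) by (intro sum.mono_neutral_left) (auto simp: gamma_ratio_nth_eq_0)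
  also have "\<dots> = (\<Sum>n=m..M. fls_nth f n * fls_nth (gamma_ratio n) k)"
    by (intro sum.mono_neutral_right) (auto simp: assms(1))
  finally show ?thesis .
qed

lemma mellin_const_mult: "mellin (fls_const c * f) = fls_const c * mellin f"
proof (rule fls_eqI)
  fix k
  have "fls_nth (mellin (fls_const c * f)) k =
      (\<Sum>n=fls_subdegree f..k. fls_nth (fls_const c * f) n * fls_nth (gamma_ratio n) k)"
    by (rule mellin_nth) auto
  also have "\<dots> = c * fls_nth (mellin f) k"
    by (subst mellin_nth[of "fls_subdegree f" f k k]) (auto simp: sum_distrib_left mult_ac)
  finally show "fls_nth (mellin (fls_const c * f)) k = fls_nth (fls_const c * mellin f) k"
    by simp
qed

lemma mellin_add: "mellin (f + g) = mellin f + mellin g"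
proof (rule fls_eqI)
  fix k
  define m where "m = min (fls_subdegree f) (fls_subdegree g)"
  have "fls_nth f n = 0" "fls_nth g n = 0" if "n < m" for n
    using that by (auto simp: m_def)
  then show "fls_nth (mellin (f + g)) k = fls_nth (mellin f + mellin g) k"
    by (simp add: mellin_nth[of m _ k k] sum.distrib algebra_simps)
qed

lemma mellin_diff: "mellin (f - g) = mellin f - mellin g"
  using mellin_add[of "f - g" g] by simp

text \<open>
  On \<open>x\<^sup>n\<close> this is \<open>Z \<Gamma>(Z - n) = \<Gamma>(Z - n + 1) + n \<Gamma>(Z - n)\<close>: the first summand comes from the factor
  \<open>1/x\<close>, the second from \<open>x d/dx\<close>. Here \<^const>\<open>fls_X_inv\<close> stands for \<open>1/x\<close> on the left and for \<open>Z\<close>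
  on the right.
\<close>

lemma mellin_twisted_deriv:
  "mellin (twisted_deriv (fls_const s + fls_X_inv) f) = (Z_ser + fls_const s) * mellin f"
proof (rule fls_eqI)
  fix k
  \<comment> \<open>\<open>1/x\<close> lowers the order by one\<close>
  define m where "m = fls_subdegree f - 1"
  define f' where "f' = twisted_deriv (fls_const s + fls_X_inv) f"
  have f': "fls_nth f' n = (of_int n + s) * fls_nth f n + fls_nth f (n + 1)" for n
    by (simp add: f'_def twisted_deriv_def distrib_right fls_X_times_conv_shift
        fls_X_inv_times_conv_shift)
  have f0: "fls_nth f n = 0" "fls_nth f' n = 0" if "n < m" for n
    using that by (auto simp: m_def f')
  have step: "fls_nth (gamma_ratio n) (k + 1) =
      fls_nth (gamma_ratio (n - 1)) k + of_int n * fls_nth (gamma_ratio n) k" for n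
  proof -
    have "fls_X_inv * gamma_ratio n = gamma_ratio (n - 1) + fls_const (of_int n) * gamma_ratio n"
      by (simp add: gamma_ratio_minus_1 fls_of_int algebra_simps)
    then show ?thesis
      by (simp add: fls_X_inv_times_conv_shift fls_eq_iff)
  qed
  let ?b = "\<lambda>n. fls_nth (gamma_ratio n) k"
  have shift: "(\<Sum>n=m..k+1. fls_nth f n * ?b (n - 1)) = (\<Sum>n=m..k+1. fls_nth f (n + 1) * ?b n)"
  proof -
    have "(\<Sum>n=m..k+1. fls_nth f n * ?b (n - 1)) = (\<Sum>n=m-1..k. fls_nth f (n + 1) * ?b n)"
      by (rule sum.reindex_bij_witness[of _ "\<lambda>n. n + 1" "\<lambda>n. n - 1"]) auto
    also have "\<dots> = (\<Sum>n=m-1..k+1. fls_nth f (n + 1) * ?b n)"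
      by (intro sum.mono_neutral_left) (auto simp: gamma_ratio_nth_eq_0)
    also have "\<dots> = (\<Sum>n=m..k+1. fls_nth f (n + 1) * ?b n)"
      by (intro sum.mono_neutral_right) (auto simp: m_def)
    finally show ?thesis .
  qed
  have "fls_nth ((Z_ser + fls_const s) * mellin f) k =
      fls_nth (mellin f) (k + 1) + s * fls_nth (mellin f) k"
    by (simp add: distrib_right fls_X_inv_times_conv_shift)
  also have "fls_nth (mellin f) (k + 1) =
      (\<Sum>n=m..k+1. fls_nth f n * (?b (n - 1) + of_int n * ?b n))"
    by (simp only: mellin_nth[OF f0(1) order_refl] step)
  also have "fls_nth (mellin f) k = (\<Sum>n=m..k+1. fls_nth f n * ?b n)"
    by (rule mellin_nth[OF f0(1)]) simp_all
  also have "(\<Sum>n=m..k+1. fls_nth f n * (?b (n - 1) + of_int n * ?b n)) +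
      s * (\<Sum>n=m..k+1. fls_nth f n * ?b n) =
      (\<Sum>n=m..k+1. fls_nth f n * ?b (n - 1)) +
      (\<Sum>n=m..k+1. (of_int n + s) * fls_nth f n * ?b n)"
    unfolding sum_distrib_left sum.distrib[symmetric] by (simp add: algebra_simps)
  also have "\<dots> = (\<Sum>n=m..k+1. fls_nth f' n * ?b n)"
    unfolding shift by (simp add: f' sum.distrib[symmetric] algebra_simps)
  also have "\<dots> = fls_nth (mellin f') k"
    by (rule mellin_nth[OF f0(2), symmetric]) simp_all
  finally show "fls_nth (mellin (twisted_deriv (fls_const s + fls_X_inv) f)) k =
      fls_nth ((Z_ser + fls_const s) * mellin f) k"
    by (simp add: f'_def)
qed


section \<open>The shift\<close>

lemma shift4_point: "fps_X / (1 + 4 * fps_X) \<noteq> (0 :: complex fps)"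
  "fps_nth (fps_X / (1 + 4 * fps_X) :: complex fps) 0 = 0"
  "subdegree (fps_X / (1 + 4 * fps_X) :: complex fps) = 1"
proof -
  have unit: "fps_nth (1 + 4 * fps_X :: complex fps) 0 \<noteq> 0"
    by simp
  then have eq: "fps_X / (1 + 4 * fps_X) = fps_X * inverse (1 + 4 * fps_X :: complex fps)"
    by (simp add: fps_divide_unit)
  have "subdegree (inverse (1 + 4 * fps_X :: complex fps)) = 0"
    by (intro subdegree_eq_0) simp
  moreover have "inverse (1 + 4 * fps_X :: complex fps) \<noteq> 0"
    using unit by simp
  ultimately show "fps_X / (1 + 4 * fps_X) \<noteq> (0 :: complex fps)"
    "fps_nth (fps_X / (1 + 4 * fps_X) :: complex fps) 0 = 0"
    "subdegree (fps_X / (1 + 4 * fps_X) :: complex fps) = 1"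
    unfolding eq by simp_all
qed

lemma shift4_0 [simp]: "shift4 0 = 0"
  and shift4_1 [simp]: "shift4 1 = 1"
  and shift4_const [simp]: "shift4 (fls_const c) = fls_const c"
  and shift4_of_int [simp]: "shift4 (of_int i) = of_int i"
  and shift4_add: "shift4 (f + g) = shift4 f + shift4 g"
  and shift4_diff: "shift4 (f - g) = shift4 f - shift4 g"
  and shift4_mult: "shift4 (f * g) = shift4 f * shift4 g"
  unfolding shift4_def
  by (simp_all add: shift4_point fls_compose_fps_add fls_compose_fps_diff fls_compose_fps_mult)

lemma shift4_sum: "shift4 (\<Sum>x\<in>S. f x) = (\<Sum>x\<in>S. shift4 (f x))"
  by (induction S rule: infinite_finite_induct) (simp_all add: shift4_add)

text \<open>
  The shift does not lower the order in \<open>1/Z\<close>. This continuity allows it to be applied term by term to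
  the infinite sum behind \<^const>\<open>mellin\<close>.
\<close>

lemma shift4_nth_eq_0:
  assumes "\<And>j. j \<le> N \<Longrightarrow> fls_nth f j = 0" "k \<le> N"
  shows "fls_nth (shift4 f) k = 0"
proof (cases "f = 0")
  case False
  let ?w = "fps_to_fls (fps_X / (1 + 4 * fps_X) :: complex fps)"
  have "N + 1 \<le> fls_subdegree f"
    using False assms(1) by (intro fls_subdegree_geI) auto
  moreover have "fls_subdegree ?w = 1"
    by (simp add: fls_subdegree_fls_to_fps shift4_point(3))
  then have "fls_subdegree (?w powi fls_subdegree f) = fls_subdegree f"
    by (simp only: fls_subdegree_power_int mult_1_right)
  moreover have "0 \<le> fls_subdegree (fps_to_fls (fls_base_factor_to_fps f oo
      (fps_X / (1 + 4 * fps_X))))"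
    by (rule fls_subdegree_fls_to_fps_gt0)
  ultimately show ?thesis
    using assms(2) unfolding shift4_def fls_compose_fps_def
    by (intro fls_times_nth_eq0) linarith
qed simp

text \<open>
  This is \<open>\<Gamma>(Z + 4 - n) / \<Gamma>(Z + 4) \<cdot> \<Gamma>(Z + 4) / \<Gamma>(Z) = \<Gamma>(Z - (n - 4)) / \<Gamma>(Z)\<close>.
\<close>

lemma gamma_ratio_shift4:
  "shift4 (gamma_ratio n) * gamma_ratio (- 4) = gamma_ratio (n - 4)"
proof (induction n rule: int_induct[where k = 0])
  case base
  then show ?case by (simp add: gamma_ratio_def)
next
  case (step1 i)
  have eq: "shift4 (gamma_ratio i) = (Z_ser - of_int (i - 3)) * shift4 (gamma_ratio (i + 1))"
    using gamma_ratio_minus_1[of "i + 1"]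
    by (simp add: shift4_mult shift4_diff shift4_Z del: of_int_add) simp
  have "(Z_ser - of_int (i - 3)) * (shift4 (gamma_ratio (i + 1)) * gamma_ratio (- 4)) =
      gamma_ratio (i - 4)"
    using step1.IH by (simp only: eq mult.assoc)
  also have "\<dots> = (Z_ser - of_int (i - 3)) * gamma_ratio (i - 3)"
    using gamma_ratio_minus_1[of "i - 3"] by simp
  finally show ?case
    using Z_minus_nonzero[of "i - 3"] by simp
next
  case (step2 i)
  have "shift4 (gamma_ratio (i - 1)) = (Z_ser - of_int (i - 4)) * shift4 (gamma_ratio i)"
    by (simp add: gamma_ratio_minus_1 shift4_mult shift4_diff shift4_Z)
  then show ?case
    using step2.IH gamma_ratio_minus_1[of "i - 4"] by (simp add: mult.assoc)
qed

lemma gamma_ratio_minus_4: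
  "gamma_ratio (- 4) = Z_ser * (Z_ser + 1) * (Z_ser + 2) * (Z_ser + 3)"
  by (simp add: gamma_ratio_def eval_nat_numeral)

text \<open>
  Term by term this is \<open>gamma_ratio_shift4\<close>. For a fixed coefficient \<open>k\<close> the series is cut after
  \<open>n = k + 4\<close>: the rest has order above \<open>k + 4\<close> in \<open>1/Z\<close>, the shift keeps that, and the factor
  \<open>\<Gamma>(Z + 4) / \<Gamma>(Z)\<close>, of degree 4 in \<open>Z\<close>, leaves it above \<open>k\<close>.
\<close>

lemma mellin_shift4:
  "shift4 (mellin f) * gamma_ratio (- 4) = mellin (fls_X_inv ^ 4 * f)"
proof (rule fls_eqI)
  fix k
  define m where "m = fls_subdegree f"
  define R where "R = mellin f - (\<Sum>n=m..k+4. fls_const (fls_nth f n) * gamma_ratio n)"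
  have "fls_nth R j = 0" if "j \<le> k + 4" for j
    using that mellin_nth[of m f j "k + 4"] by (simp add: R_def m_def fls_nth_sum)
  then have shR: "fls_nth (shift4 R) j = 0" if "j \<le> k + 4" for j
    using that by (rule shift4_nth_eq_0)
  have rest: "fls_nth (shift4 R * gamma_ratio (- 4)) k = 0"
  proof (cases "shift4 R = 0")
    case False
    then have "k + 5 \<le> fls_subdegree (shift4 R)"
      using shR by (intro fls_subdegree_geI) auto
    then show ?thesis
      using gamma_ratio_subdegree[of "- 4"] by (intro fls_times_nth_eq0) simp
  qed simp
  have "shift4 (mellin f) =
      (\<Sum>n=m..k+4. fls_const (fls_nth f n) * shift4 (gamma_ratio n)) + shift4 R"
    by (simp add: R_def shift4_diff shift4_sum shift4_mult)
  then have "shift4 (mellin f) * gamma_ratio (- 4) =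
      (\<Sum>n=m..k+4. fls_const (fls_nth f n) * gamma_ratio (n - 4)) + shift4 R * gamma_ratio (- 4)"
    by (simp add: distrib_right sum_distrib_right mult.assoc gamma_ratio_shift4)
  then have "fls_nth (shift4 (mellin f) * gamma_ratio (- 4)) k =
      (\<Sum>n=m..k+4. fls_nth f n * fls_nth (gamma_ratio (n - 4)) k)"
    by (simp add: rest fls_nth_sum)
  also have "\<dots> = (\<Sum>n=m-4..k. fls_nth f (n + 4) * fls_nth (gamma_ratio n) k)"
    by (rule sum.reindex_bij_witness[of _ "\<lambda>n. n + 4" "\<lambda>n. n - 4"]) auto
  also have "\<dots> = fls_nth (mellin (fls_X_inv ^ 4 * f)) k"
    by (subst mellin_nth[of "m - 4" _ k k]) (auto simp: m_def fls_X_inv_power_times_conv_shift)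
  finally show "fls_nth (shift4 (mellin f) * gamma_ratio (- 4)) k =
      fls_nth (mellin (fls_X_inv ^ 4 * f)) k" .
qed

text \<open>
  Convergence in the adic metric, from partial sums whose coefficients stabilise.
\<close>

lemma fls_sumsI:
  fixes f :: "nat \<Rightarrow> 'a :: ab_group_add fls"
  assumes "\<And>N k. k < int N \<Longrightarrow> fls_nth (\<Sum>n<N. f n) k = fls_nth s k"
  shows "f sums s"
proof -
  have "dist (\<Sum>n<N. f n) s \<le> (1/2) ^ N" for N
  proof (cases "(\<Sum>n<N. f n) = s")
    case False
    let ?d = "fls_subdegree ((\<Sum>n<N. f n) - s)"
    have d: "int N \<le> ?d"
      using False assms by (intro fls_subdegree_geI) auto
    then have "(1/2 :: real) ^ nat ?d \<le> (1/2) ^ N"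
      by (intro power_decreasing) auto
    moreover have "0 \<le> ?d"
      using d by linarith
    ultimately show ?thesis
      using False unfolding dist_fls_def
      by (simp only: if_False if_True power_one_over inverse_eq_divide)
  qed simp
  then have le: "\<forall>\<^sub>F N in sequentially.
      norm (dist (\<Sum>n<N. f n) s) \<le> norm ((1/2 :: real) ^ N) * 1"
    by (intro always_eventually allI) simp
  have "(\<lambda>N. (1/2 :: real) ^ N) \<longlonglongrightarrow> 0"
    by (intro LIMSEQ_realpow_zero) auto
  then have "(\<lambda>N. dist (\<Sum>n<N. f n) s) \<longlonglongrightarrow> 0"
    using le by (rule tendsto_0_le)
  then show ?thesis
    unfolding sums_def by (rule iffD2[OF tendsto_dist_iff])
qed

lemma F_ser_eq_mellin: "F_ser \<alpha> = mellin (fps_to_fls (Abs_fps (G_coeff \<alpha>)))"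
proof -
  let ?g = "fps_to_fls (Abs_fps (G_coeff \<alpha>))"
  have F_term_eq: "F_term \<alpha> n = fls_const (G_coeff \<alpha> n) * gamma_ratio (int n)" for n
    by (simp add: F_term_def gamma_ratio_def)
  have "F_term \<alpha> sums mellin ?g"
  proof (rule fls_sumsI)
    fix N k assume "k < int N"
    then have "fls_nth (mellin ?g) k =
        (\<Sum>n=0..int N - 1. fls_nth ?g n * fls_nth (gamma_ratio n) k)"
      by (intro mellin_nth) auto
    also have "\<dots> = (\<Sum>n<N. G_coeff \<alpha> n * fls_nth (gamma_ratio (int n)) k)"
      by (rule sum.reindex_bij_witness[of _ int nat]) auto
    finally show "fls_nth (\<Sum>n<N. F_term \<alpha> n) k = fls_nth (mellin ?g) k"
      by (simp add: F_term_eq fls_nth_sum)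
  qed
  then show ?thesis
    by (simp add: F_ser_def sums_iff)
qed

section \<open>The difference equations of formal series\<close>

text \<open>
  The Mellin transform of \<open>product_ode\<close> for \<open>c = 1/p = (1 - \<i>)/2\<close> and \<open>d = 1/q = (1 + \<i>)/2\<close>.
\<close>

lemma F_ser_gauged_equation:
  "shift4 (F_ser \<alpha>) * (Z_ser * (Z_ser + 1) * (Z_ser + 2) * (Z_ser + 3)) =
     (Z_ser + 1) * (Z_ser + 3) * ((Z_ser + 1)\<^sup>2 - 4 * fls_const (\<alpha>\<^sup>2)) * F_ser \<alpha>"
proof -
  define g where "g = fps_to_fls (Abs_fps (G_coeff \<alpha>))"
  let ?c = "(1 - \<i>) / 2" and ?d = "(1 + \<i>) / 2"
  let ?\<delta> = "twisted_deriv (1 + fls_X_inv)"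
  have inv: "?c * (1 + \<i>) = 1" "?d * (1 - \<i>) = 1" and cd: "?c + ?d = 1" "?c\<^sup>2 + ?d\<^sup>2 = 0"
    by (simp_all add: power2_eq_square field_simps)
  have ode: "twisted_deriv (3 + fls_X_inv) (?\<delta> (?\<delta> (?\<delta> g) - fls_const (4 * \<alpha>\<^sup>2) * g)) =
      fls_X_inv ^ 4 * g"
    using product_ode[OF cd bessel_series_ode[OF inv(1)] bessel_series_ode[OF inv(2)], of \<alpha>]
    by (simp only: g_def G_series)
  have "mellin (twisted_deriv (fls_X_inv + s) f) = (Z_ser + s) * mellin f" if "s = fls_const a" for s a f
    using mellin_twisted_deriv[of a f] by (simp add: that add.commute)
  from this[of 1 1] this[of 3 3]
  have mellin_deriv: "mellin (?\<delta> f) = (Z_ser + 1) * mellin f"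
    "mellin (twisted_deriv (3 + fls_X_inv) f) = (Z_ser + 3) * mellin f" for f
    by (simp_all add: add.commute)
  have factor: "r * (p * (p * (p * f) - c * f)) = p * r * (p\<^sup>2 - c) * f" for p r c f :: "complex fls"
    by (simp add: power2_eq_square algebra_simps)
  have four: "fls_const (4 * \<alpha>\<^sup>2) = 4 * fls_const (\<alpha>\<^sup>2)"
    by (simp flip: fls_const_mult_const)
  have "shift4 (mellin g) * gamma_ratio (- 4) =
      (Z_ser + 3) * ((Z_ser + 1) * ((Z_ser + 1) * ((Z_ser + 1) * mellin g)
        - fls_const (4 * \<alpha>\<^sup>2) * mellin g))"
    unfolding mellin_shift4 ode[symmetric] mellin_deriv mellin_diff mellin_const_mult ..
  then show ?thesis
    unfolding F_ser_eq_mellin g_def[symmetric] gamma_ratio_minus_4 factor four .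
qed

lemma F_ser_equation:
  "shift4 (F_ser \<alpha>) * (Z_ser * (Z_ser + 2)) =
     F_ser \<alpha> * ((Z_ser + 1)\<^sup>2 - 4 * fls_const (\<alpha>\<^sup>2))"
proof -
  have "(Z_ser + 1) * (Z_ser + 3) \<noteq> 0"
    using Z_minus_nonzero[of "- 1"] Z_minus_nonzero[of "- 3"] by simp
  moreover have "((Z_ser + 1) * (Z_ser + 3)) * (shift4 (F_ser \<alpha>) * (Z_ser * (Z_ser + 2))) =
     ((Z_ser + 1) * (Z_ser + 3)) * (F_ser \<alpha> * ((Z_ser + 1)\<^sup>2 - 4 * fls_const (\<alpha>\<^sup>2)))"
  proof -
    have "(p * r) * (s * (z * t)) = s * (z * p * t * r)" "(p * r) * (f * e) = p * r * e * f"
      for p r s z t e f :: "complex fls"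
      by (simp_all only: mult_ac)
    then show ?thesis
      using F_ser_gauged_equation[of \<alpha>] by metis
  qed
  ultimately show ?thesis
    by (rule iffD1[OF mult_left_cancel])
qed

lemma G_gauged_equation:
  "shift4_gauged (G_gauged \<alpha>) =
     smult ((Z_ser + 1) * (Z_ser + 3) * ((Z_ser + 1)\<^sup>2 - 4 * fls_const (\<alpha>\<^sup>2))) (G_gauged \<alpha>)"
proof -
  have "shift4_gauged (G_gauged \<alpha>) =
      smult (shift4 (F_ser \<alpha>) * (Z_ser * (Z_ser + 1) * (Z_ser + 2) * (Z_ser + 3))) Gamma_sym"
  proof -
    have "pcompose (map_poly shift4 (smult f Gamma_sym)) (smult r Gamma_sym) =
        smult (shift4 f * r) Gamma_sym" for f r
      by (simp add: Gamma_sym_def map_poly_pCons pcompose_pCons)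
    then show ?thesis
      unfolding shift4_gauged_def G_gauged_def .
  qed
  then show ?thesis
    unfolding F_ser_gauged_equation G_gauged_def smult_smult .
qed

section \<open>The rational case\<close>

text \<open>
  The embedding of polynomials in \<open>Z\<close> into Laurent series in \<open>1/Z\<close>. It is an injective ring
  homomorphism that intertwines the substitution \<open>Z \<mapsto> Z + 4\<close> with \<^const>\<open>shift4\<close>, so an identity of
  series between images of polynomials can be pulled back and evaluated at points.
\<close>

definition expand_at_infinity :: "complex poly \<Rightarrow> complex fls" where
  "expand_at_infinity P = poly (map_poly fls_const P) Z_ser"

lemma expand_at_infinity_0 [simp]: "expand_at_infinity 0 = 0"
  and expand_at_infinity_pCons:
    "expand_at_infinity (pCons a P) = fls_const a + Z_ser * expand_at_infinity P"
  by (simp_all add: expand_at_infinity_def map_poly_pCons)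

lemma expand_at_infinity_1: "expand_at_infinity 1 = 1"
  by (simp add: expand_at_infinity_def)

lemma expand_at_infinity_add:
  "expand_at_infinity (P + Q) = expand_at_infinity P + expand_at_infinity Q"
  by (induction P Q rule: poly_induct2)
    (simp_all add: expand_at_infinity_pCons algebra_simps flip: fls_plus_const)

lemma expand_at_infinity_smult:
  "expand_at_infinity (smult c P) = fls_const c * expand_at_infinity P"
  by (induction P)
    (simp_all add: expand_at_infinity_pCons algebra_simps flip: fls_const_mult_const)

lemma expand_at_infinity_mult:
  "expand_at_infinity (P * Q) = expand_at_infinity P * expand_at_infinity Q"
  by (induction P)
    (simp_all add: expand_at_infinity_pCons expand_at_infinity_add expand_at_infinity_smult
      algebra_simps)

lemma expand_at_infinity_sum:
  "expand_at_infinity (\<Sum>x\<in>S. P x) = (\<Sum>x\<in>S. expand_at_infinity (P x))"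
  by (induction S rule: infinite_finite_induct) (simp_all add: expand_at_infinity_add)

lemma expand_at_infinity_prod:
  "expand_at_infinity (\<Prod>x\<in>S. P x) = (\<Prod>x\<in>S. expand_at_infinity (P x))"
  by (induction S rule: infinite_finite_induct)
    (simp_all add: expand_at_infinity_1 expand_at_infinity_mult)

lemma expand_at_infinity_nth:
  "fls_nth (expand_at_infinity P) k = (if k \<le> 0 then coeff P (nat (- k)) else 0)"
proof (induction P arbitrary: k)
  case (pCons a P)
  have "nat (- k) = Suc (nat (- (k + 1)))" if "k < 0"
    using that by simp
  then show ?case
    using pCons.IH[of "k + 1"]
    by (cases "k < 0") (auto simp: expand_at_infinity_pCons fls_X_inv_times_conv_shift)
qed simp

lemma inj_expand_at_infinity: "inj expand_at_infinity"
proof (rule injI, rule poly_eqI)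
  fix P Q n
  assume "expand_at_infinity P = expand_at_infinity Q"
  then show "coeff P n = coeff Q n"
    using expand_at_infinity_nth[of P "- int n"] expand_at_infinity_nth[of Q "- int n"] by simp
qed

lemma shift4_expand_at_infinity:
  "shift4 (expand_at_infinity P) = expand_at_infinity (P \<circ>\<^sub>p [:4, 1:])"
  by (induction P)
    (simp_all add: expand_at_infinity_pCons expand_at_infinity_add expand_at_infinity_mult
      distrib_right expand_at_infinity_smult shift4_add shift4_mult shift4_Z pcompose_pCons)


text \<open>
  Used twice with the same shape: for \<open>x j = Z - j\<close> as a Laurent series and for \<open>x j = z - j\<close> as a number.
\<close>

lemma divide_prod_mult_prod:
  fixes x :: "nat \<Rightarrow> 'a :: field"
  assumes "n \<le> M" "\<And>j. 1 \<le> j \<Longrightarrow> j \<le> M \<Longrightarrow> x j \<noteq> 0"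
  shows "c / (\<Prod>j=1..n. x j) * (\<Prod>j=1..M. x j) = c * (\<Prod>j=n+1..M. x j)"
proof -
  have "(\<Prod>j=1..M. x j) = (\<Prod>j=1..n. x j) * (\<Prod>j=n+1..M. x j)"
    using prod.ub_add_nat[of 1 n x "M - n"] assms(1) by simp
  moreover have "(\<Prod>j=1..n. x j) \<noteq> 0"
    using assms by auto
  ultimately show ?thesis
    by simp
qed

text \<open>
  One pair of polynomials represents both the series and the function. The denominator is
  \<open>(Z - 1) \<cdots> (Z - M)\<close> with \<open>M\<close> the largest index of a nonzero \<open>G\<^sub>n\<close>; this choice makes its zeros
  exactly the points of \<^const>\<open>F_poles\<close>.
\<close>

lemma F_common_denominator:
  assumes "\<alpha> - 1/2 \<in> \<int>"
  obtains N Q where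
    "F_ser \<alpha> * expand_at_infinity Q = expand_at_infinity N"
    "\<And>z. z \<notin> F_poles \<alpha> \<Longrightarrow> poly Q z \<noteq> 0"
    "\<And>z. z \<notin> F_poles \<alpha> \<Longrightarrow> F_rat \<alpha> z * poly Q z = poly N z"
proof -
  define S where "S = {n. G_coeff \<alpha> n \<noteq> 0}"
  define M where "M = Max S"
  have fin: "finite S"
    unfolding S_def by (rule finite_G_coeff[OF assms])
  have "0 \<in> S"
    by (simp add: S_def G_coeff_def a_coeff_def)
  with fin have M: "G_coeff \<alpha> M \<noteq> 0" "\<And>n. n \<in> S \<Longrightarrow> n \<le> M"
    using Max_in[of S] by (auto simp: M_def S_def)
  have lin: "expand_at_infinity [:- of_nat j, 1:] = Z_ser - of_nat j" for j
    by (simp add: expand_at_infinity_pCons fls_of_nat)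
  define Q :: "complex poly" where "Q = (\<Prod>j=1..M. [:- of_nat j, 1:])"
  define N where "N = (\<Sum>n\<in>S. smult (G_coeff \<alpha> n) (\<Prod>j=n+1..M. [:- of_nat j, 1:]))"
  show thesis
  proof (rule that[of Q N])
    have "F_ser \<alpha> = (\<Sum>n\<in>S. F_term \<alpha> n)"
      unfolding F_ser_def using fin by (intro suminf_finite) (auto simp: S_def F_term_def)
    moreover have "F_term \<alpha> n * expand_at_infinity Q =
        expand_at_infinity (smult (G_coeff \<alpha> n) (\<Prod>j=n+1..M. [:- of_nat j, 1:]))"
      if "n \<in> S" for n
      unfolding F_term_def Q_def expand_at_infinity_prod expand_at_infinity_smult lin
      using M(2)[OF that] Z_minus_nonzero[of "int j" for j]
      by (intro divide_prod_mult_prod) auto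
    ultimately show "F_ser \<alpha> * expand_at_infinity Q = expand_at_infinity N"
      by (simp add: N_def sum_distrib_right expand_at_infinity_sum)
  next
    fix z assume z: "z \<notin> F_poles \<alpha>"
    have nz: "z - of_nat j \<noteq> 0" if "1 \<le> j" "j \<le> M" for j
      using z that M(1) unfolding F_poles_def by auto
    have Q_eval: "poly Q z = (\<Prod>j=1..M. z - of_nat j)"
      by (simp add: Q_def poly_prod)
    then show "poly Q z \<noteq> 0"
      using nz by simp
    have "G_coeff \<alpha> n / (\<Prod>j=1..n. z - of_nat j) * poly Q z =
        G_coeff \<alpha> n * (\<Prod>j=n+1..M. z - of_nat j)" if "n \<in> S" for n
      unfolding Q_eval using M(2)[OF that] nz by (rule divide_prod_mult_prod)
    then show "F_rat \<alpha> z * poly Q z = poly N z"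
      by (simp add: F_rat_def S_def[symmetric] N_def sum_distrib_right poly_sum poly_prod)
  qed
qed

text \<open>
  The identity holds as an identity of polynomials after multiplication by the denominators of
  \<open>F(Z)\<close> and \<open>F(Z + 4)\<close>, neither of which vanishes at \<open>z\<close>. The factor \<open>(Z + 1) (Z + 3)\<close> of the gauged
  equation was cancelled in the field of series, so the identity also holds at \<open>z = - 1\<close> and \<open>z = - 3\<close>.
\<close>

lemma F_rat_equation:
  assumes "\<alpha> - 1/2 \<in> \<int>" "z \<notin> F_poles \<alpha>" "z + 4 \<notin> F_poles \<alpha>"
  shows "F_rat \<alpha> (z + 4) * (z * (z + 2)) = F_rat \<alpha> z * ((z + 1)\<^sup>2 - 4 * \<alpha>\<^sup>2)"
proof -
  obtain N Q where NQ: "F_ser \<alpha> * expand_at_infinity Q = expand_at_infinity N"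
    and nz: "\<And>z. z \<notin> F_poles \<alpha> \<Longrightarrow> poly Q z \<noteq> 0"
    and eval: "\<And>z. z \<notin> F_poles \<alpha> \<Longrightarrow> F_rat \<alpha> z * poly Q z = poly N z"
    using F_common_denominator[OF assms(1)] by metis
  define N4 Q4 where "N4 = N \<circ>\<^sub>p [:4, 1:]" and "Q4 = Q \<circ>\<^sub>p [:4, 1:]"
  define a b :: "complex poly"
    where "a = [:0, 1:] * [:2, 1:]" and "b = [:1, 1:] * [:1, 1:] + [:- (4 * \<alpha>\<^sup>2):]"
  let ?E = expand_at_infinity
  have four: "fls_const (4 * \<alpha>\<^sup>2) = 4 * fls_const (\<alpha>\<^sup>2)"
    by (simp flip: fls_const_mult_const)
  have Eb: "?E b = (Z_ser + 1)\<^sup>2 - 4 * fls_const (\<alpha>\<^sup>2)"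
    unfolding b_def expand_at_infinity_add expand_at_infinity_mult
    by (simp add: expand_at_infinity_pCons power2_eq_square[of "Z_ser + 1"] four add.commute)
  have Ea: "?E a = Z_ser * (Z_ser + 2)"
    unfolding a_def expand_at_infinity_mult by (simp add: expand_at_infinity_pCons add.commute)
  have mult_rearrange: "(f * r) * (q4 * q) = (f * q) * q4 * r" for f r q q4 :: "complex fls"
    by (simp only: mult_ac)
  have "?E (N4 * Q * a) = (shift4 (F_ser \<alpha>) * ?E a) * (?E Q4 * ?E Q)"
    using arg_cong[OF NQ, of shift4]
    by (simp add: expand_at_infinity_mult N4_def Q4_def shift4_mult shift4_expand_at_infinity mult_ac)
  also have "\<dots> = (F_ser \<alpha> * ?E Q) * ?E Q4 * ?E b"
    unfolding Ea F_ser_equation Eb by (rule mult_rearrange)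
  also have "\<dots> = ?E (N * Q4 * b)"
    unfolding NQ expand_at_infinity_mult ..
  finally have "N4 * Q * a = N * Q4 * b"
    by (rule injD[OF inj_expand_at_infinity])
  then have "poly (N4 * Q * a) z = poly (N * Q4 * b) z"
    by simp
  moreover have "poly N4 z = poly N (z + 4)" "poly Q4 z = poly Q (z + 4)"
    "poly a z = z * (z + 2)" "poly b z = (z + 1)\<^sup>2 - 4 * \<alpha>\<^sup>2"
    by (simp_all add: N4_def Q4_def a_def b_def poly_pcompose power2_eq_square algebra_simps)
  ultimately have "poly N (z + 4) * poly Q z * (z * (z + 2)) =
      poly N z * poly Q (z + 4) * ((z + 1)\<^sup>2 - 4 * \<alpha>\<^sup>2)"
    by simp
  then have "poly Q z * poly Q (z + 4) * (F_rat \<alpha> (z + 4) * (z * (z + 2))) =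
      poly Q z * poly Q (z + 4) * (F_rat \<alpha> z * ((z + 1)\<^sup>2 - 4 * \<alpha>\<^sup>2))"
    by (simp only: eval[OF assms(2), symmetric] eval[OF assms(3), symmetric] mult_ac)
  then show ?thesis
    using nz assms by simp
qed

lemma G_fun_equation:
  assumes "\<alpha> - 1/2 \<in> \<int>" "z \<notin> \<int>\<^sub>\<le>\<^sub>0" "z \<notin> F_poles \<alpha>" "z + 4 \<notin> F_poles \<alpha>"
  shows "G_fun \<alpha> (z + 4) = (z + 1) * (z + 3) * ((z + 1)\<^sup>2 - 4 * \<alpha>\<^sup>2) * G_fun \<alpha> z"
proof -
  have "G_fun \<alpha> (z + 4) =
      (z + 1) * (z + 3) * Gamma z * (F_rat \<alpha> (z + 4) * (z * (z + 2)))"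
    by (simp add: G_fun_def Gamma_plus4[OF assms(2)])
  also have "\<dots> = (z + 1) * (z + 3) * ((z + 1)\<^sup>2 - 4 * \<alpha>\<^sup>2) * G_fun \<alpha> z"
    unfolding F_rat_equation[OF assms(1,3,4)] G_fun_def by (simp only: mult_ac)
  finally show ?thesis .
qed

theorem corollary1p2:
  fixes \<alpha> A :: complex
  assumes "A = \<alpha>\<^sup>2"
  shows
    "shift4 (F_ser \<alpha>) * (Z_ser * (Z_ser + 2)) =
       F_ser \<alpha> * ((Z_ser + 1)\<^sup>2 - 4 * fls_const A)
     \<and> shift4_gauged (G_gauged \<alpha>) =
         smult ((Z_ser + 1) * (Z_ser + 3) * ((Z_ser + 1)\<^sup>2 - 4 * fls_const A)) (G_gauged \<alpha>)
     \<and> (\<alpha> - 1/2 \<in> \<int> \<longrightarrow>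
         (\<forall>z. z \<notin> F_poles \<alpha> \<longrightarrow> z + 4 \<notin> F_poles \<alpha> \<longrightarrow>
            F_rat \<alpha> (z + 4) * (z * (z + 2)) = F_rat \<alpha> z * ((z + 1)\<^sup>2 - 4 * A)) \<and>
         (\<forall>z. z \<notin> \<int>\<^sub>\<le>\<^sub>0 \<longrightarrow> z \<notin> F_poles \<alpha> \<longrightarrow> z + 4 \<notin> F_poles \<alpha> \<longrightarrow>
            G_fun \<alpha> (z + 4) =
              (z + 1) * (z + 3) * ((z + 1)\<^sup>2 - 4 * A) * G_fun \<alpha> z))"
  unfolding assms
  using F_ser_equation G_gauged_equation F_rat_equation G_fun_equation by blast

end
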